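(* Let $X$ be a diffeological space such that $D(X)$ is Tychonoff. Then the topology of $G(D(X))$ is coarser than (i.e. contained in) the topology of $D(F(X))$. If we further assume that $D(F(X))$ is a topological vector space, then $D(F(X))=G(D(X))$, i.e. the two topologies coincide.
   Context: All vector spaces are over $\mathbb{R}$. A diffeological space is a set $X$ with a collection of maps $U\to X$ (called plots), where $U$ ranges over open subsets of $\mathbb{R}^n$, $n\in\mathbb{N}$ arbitrary, such that: every constant map is a plot; the precomposition of a plot with a smooth map between open subsets of Euclidean spaces is a plot; a map that restricts to a plot on each member of some open cover of its domain is a plot. The $D$-topology on a diffeological space $X$ is the finest topology for which all plots are continuous; $D(X)$ denotes $X$ with this topology. The free diffeological vector space $F(X)$ on a diffeological space $X$ is the vector space $\bigoplus_{x\in X}\mathbb{R}$ with basis $\{[x]:x\in X\}$, whose plots are the maps locally of the form $u\mapsto\sum_{i=1}^n r_i(u)[q_i(u)]$ with $n\ge 0$, $r_i$ smooth real functions and $q_i$ plots of $X$. For a Tychonoff topological space $Y$, $G(Y)$ denotes the free topological vector space on $Y$: a topological vector space with a continuous map $j_Y:Y\to G(Y)$ such that for every topological vector space $W$ and every continuous map $h:Y\to W$ there is a unique continuous linear map $k:G(Y)\to W$ with $h=k\circ j_Y$. It is known that $G(Y)$ exists and that its underlying vector space is $\bigoplus_{y\in Y}\mathbb{R}$ with $j_Y(y)=[y]$ the basis element; so $F(X)$ and $G(D(X))$ have the same underlying vector space, on which the topologies are compared. A topological vector space is a vector space with a topology for which addition (from the product topology) and scalar multiplication are continuous. Tychonoff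 means completely regular and $T_1$. *)

theory Defs
  imports "HOL-Analysis.Analysis" "HOL-Analysis.Finite_Function_Topology"
begin

definition coarser_topology :: "'a topology \<Rightarrow> 'a topology \<Rightarrow> bool" where
  "coarser_topology S T \<longleftrightarrow> topspace S = topspace T \<and> (\<forall>U. openin S U \<longrightarrow> openin T U)"

lemma coarser_topology_iff_continuous_id:
  "coarser_topology S T \<longleftrightarrow> topspace S = topspace T \<and> continuous_map T S id"
  unfolding coarser_topology_def using topology_finer_continuous_id by blast

definition Tychonoff_space :: "'a topology \<Rightarrow> bool" where
  "Tychonoff_space T \<longleftrightarrow> completely_regular_space T \<and> t1_space T"


section \<open>Smooth maps between open subsets of Euclidean spaces\<close>

text \<open>The space \<open>\<real>\<^sup>n\<close>, with \<open>n\<close> a variable of the logic, is \<^const>\<open>Euclidean_space\<close>: sequences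
  vanishing from index \<open>n\<close> on. In \<open>Ck_on n U k f\<close> the set \<open>U\<close> is meant to be open in \<open>\<real>\<^sup>n\<close>; the
  function \<open>g\<close> is the partial derivative in the \<open>i\<close>-th coordinate direction, which on \<open>U\<close> depends
  only on the values of \<open>f\<close> on \<open>U\<close>.\<close>

primrec Ck_on ::
  "nat \<Rightarrow> (nat \<Rightarrow> real) set \<Rightarrow> nat \<Rightarrow> ((nat \<Rightarrow> real) \<Rightarrow> real) \<Rightarrow> bool" where
  "Ck_on n U 0 f \<longleftrightarrow> continuous_map (subtopology (Euclidean_space n) U) euclideanreal f"
| "Ck_on n U (Suc k) f \<longleftrightarrow>
     continuous_map (subtopology (Euclidean_space n) U) euclideanreal f \<and>
     (\<forall>i<n. \<exists>g. (\<forall>x\<in>U. ((\<lambda>t. f (x(i := t))) has_real_derivative g x) (at (x i))) \<and> Ck_on n U k g)"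

definition smooth_fun :: "nat \<Rightarrow> (nat \<Rightarrow> real) set \<Rightarrow> ((nat \<Rightarrow> real) \<Rightarrow> real) \<Rightarrow> bool" where
  "smooth_fun n U f \<longleftrightarrow> (\<forall>k. Ck_on n U k f)"

definition smooth_map ::
  "nat \<Rightarrow> (nat \<Rightarrow> real) set \<Rightarrow> nat \<Rightarrow> (nat \<Rightarrow> real) set \<Rightarrow> ((nat \<Rightarrow> real) \<Rightarrow> nat \<Rightarrow> real) \<Rightarrow> bool" where
  "smooth_map m V n U f \<longleftrightarrow> f ` V \<subseteq> U \<and> (\<forall>i<n. smooth_fun m V (\<lambda>x. f x i))"


section \<open>Diffeological spaces and the D-topology\<close>

text \<open>\<open>plot n U p\<close> says that \<open>p\<close>, restricted to the open set \<open>U\<close> of \<open>\<real>\<^sup>n\<close>, is a plot of \<open>X\<close>. As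
  functions are total, \<open>plot_cong\<close> expresses that values outside \<open>U\<close> are irrelevant.\<close>

locale diffeological_space =
  fixes X :: "'a set"
    and plot :: "nat \<Rightarrow> (nat \<Rightarrow> real) set \<Rightarrow> ((nat \<Rightarrow> real) \<Rightarrow> 'a) \<Rightarrow> bool"
  assumes plot_domain: "plot n U p \<Longrightarrow> openin (Euclidean_space n) U"
    and plot_range: "plot n U p \<Longrightarrow> p ` U \<subseteq> X"
    and plot_cong: "plot n U p \<Longrightarrow> (\<And>u. u \<in> U \<Longrightarrow> q u = p u) \<Longrightarrow> plot n U q"
    and plot_const: "openin (Euclidean_space n) U \<Longrightarrow> x \<in> X \<Longrightarrow> plot n U (\<lambda>_. x)"
    and plot_compose: "plot n U p \<Longrightarrow> openin (Euclidean_space m) V \<Longrightarrow> smooth_map m V n U f \<Longrightarrow>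
                         plot m V (p \<circ> f)"
    and plot_local: "(\<And>V. V \<in> \<V> \<Longrightarrow> plot n V p) \<Longrightarrow> plot n (\<Union>\<V>) p"

definition plots_continuous ::
  "(nat \<Rightarrow> (nat \<Rightarrow> real) set \<Rightarrow> ((nat \<Rightarrow> real) \<Rightarrow> 'a) \<Rightarrow> bool) \<Rightarrow> 'a topology \<Rightarrow> bool" where
  "plots_continuous plot T \<longleftrightarrow>
     (\<forall>n U p. plot n U p \<longrightarrow> continuous_map (subtopology (Euclidean_space n) U) T p)"

definition D_topology ::
  "'a set \<Rightarrow> (nat \<Rightarrow> (nat \<Rightarrow> real) set \<Rightarrow> ((nat \<Rightarrow> real) \<Rightarrow> 'a) \<Rightarrow> bool) \<Rightarrow> 'a topology" where
  "D_topology X plot = (THE T. topspace T = X \<and> plots_continuous plot T \<and>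
     (\<forall>S. topspace S = X \<and> plots_continuous plot S \<longrightarrow> coarser_topology S T))"

lemma D_topology_characterization:
  assumes dom: "\<And>n U p. plot n U p \<Longrightarrow> openin (Euclidean_space n) U"
    and ran: "\<And>n U p. plot n U p \<Longrightarrow> p ` U \<subseteq> X"
  shows openin_D_topology: "openin (D_topology X plot) V \<longleftrightarrow>
          V \<subseteq> X \<and> (\<forall>n U p. plot n U p \<longrightarrow> openin (Euclidean_space n) {u \<in> U. p u \<in> V})"
      (is "_ \<longleftrightarrow> ?op V")
    and topspace_D_topology: "topspace (D_topology X plot) = X"
    and plots_continuous_D_topology: "plots_continuous plot (D_topology X plot)"
    and D_topology_finest: "topspace S = X \<Longrightarrow> plots_continuous plot S \<Longrightarrow>
          coarser_topology S (D_topology X plot)"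
proof -
  have "istopology ?op"
    unfolding istopology_def
  proof (intro conjI allI impI)
    fix A B n U p assume "?op A" "?op B" "plot n U p"
    moreover have "{u \<in> U. p u \<in> A \<inter> B} = {u \<in> U. p u \<in> A} \<inter> {u \<in> U. p u \<in> B}" by auto
    ultimately show "openin (Euclidean_space n) {u \<in> U. p u \<in> A \<inter> B}"
      by (simp add: openin_Int)
  next
    fix \<K> n U p assume "\<forall>K\<in>\<K>. ?op K" "plot n U p"
    moreover have "{u \<in> U. p u \<in> \<Union>\<K>} = (\<Union>K\<in>\<K>. {u \<in> U. p u \<in> K})" by auto
    ultimately show "openin (Euclidean_space n) {u \<in> U. p u \<in> \<Union>\<K>}"
      by (auto intro!: openin_Union)
  qed auto
  then have op: "openin (topology ?op) = ?op"
    by (simp add: topology_inverse')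
  have "?op X"
  proof (intro conjI allI impI)
    fix n U p assume pl: "plot n U p"
    then have "{u \<in> U. p u \<in> X} = U" using ran by blast
    then show "openin (Euclidean_space n) {u \<in> U. p u \<in> X}" using dom pl by simp
  qed simp
  then have top: "topspace (topology ?op) = X"
    unfolding topspace_def op by blast
  have sub: "topspace (subtopology (Euclidean_space n) U) = U"
    and opsub: "openin (subtopology (Euclidean_space n) U) V \<longleftrightarrow>
                  openin (Euclidean_space n) V \<and> V \<subseteq> U"
    if "plot n U p" for n U p V
    using dom[OF that] by (auto dest: openin_subset simp: openin_open_subtopology)
  have cont: "plots_continuous plot (topology ?op)"
    unfolding plots_continuous_def continuous_map_def op top
  proof (intro allI impI conjI)
    fix n U p assume pl: "plot n U p"
    show "p \<in> topspace (subtopology (Euclidean_space n) U) \<rightarrow> X"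
      using ran[OF pl] by (auto simp: sub[OF pl])
    fix V assume "?op V"
    then show "openin (subtopology (Euclidean_space n) U)
                 {u \<in> topspace (subtopology (Euclidean_space n) U). p u \<in> V}"
      unfolding sub[OF pl] opsub[OF pl] using pl by auto
  qed
  have fin: "coarser_topology S (topology ?op)"
    if S: "topspace S = X" "plots_continuous plot S" for S
    unfolding coarser_topology_def op top
  proof (intro conjI allI impI)
    fix U n W p assume "openin S U" "plot n W p"
    then show "openin (Euclidean_space n) {u \<in> W. p u \<in> U}"
      using S(2) unfolding plots_continuous_def continuous_map_def
      by (metis (mono_tags, lifting) Collect_cong sub opsub)
  qed (use S in \<open>auto dest: openin_subset\<close>)
  have eq: "D_topology X plot = topology ?op"
    unfolding D_topology_def
  proof (rule the_equality)
    fix T assume T: "topspace T = X \<and> plots_continuous plot T \<and>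
      (\<forall>S. topspace S = X \<and> plots_continuous plot S \<longrightarrow> coarser_topology S T)"
    then have "coarser_topology T (topology ?op)" "coarser_topology (topology ?op) T"
      using fin top cont by auto
    then show "T = topology ?op"
      by (auto simp: coarser_topology_def topology_eq)
  qed (use top cont fin in auto)
  show "openin (D_topology X plot) V \<longleftrightarrow> ?op V" by (simp only: eq op)
  show "topspace (D_topology X plot) = X" by (simp only: eq top)
  show "plots_continuous plot (D_topology X plot)" using cont by (simp only: eq)
  show "topspace S = X \<Longrightarrow> plots_continuous plot S \<Longrightarrow> coarser_topology S (D_topology X plot)"
    using fin by (simp only: eq)
qed


section \<open>The free diffeological vector space\<close>

definition free_space :: "'a set \<Rightarrow> ('a \<Rightarrow>\<^sub>0 real) set" where
  "free_space X = {f. Poly_Mapping.keys f \<subseteq> X}"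

definition basis_elem :: "'a \<Rightarrow> ('a \<Rightarrow>\<^sub>0 real)" where
  "basis_elem x = Poly_Mapping.single x 1"

definition free_plot ::
  "(nat \<Rightarrow> (nat \<Rightarrow> real) set \<Rightarrow> ((nat \<Rightarrow> real) \<Rightarrow> 'a) \<Rightarrow> bool) \<Rightarrow>
   nat \<Rightarrow> (nat \<Rightarrow> real) set \<Rightarrow> ((nat \<Rightarrow> real) \<Rightarrow> ('a \<Rightarrow>\<^sub>0 real)) \<Rightarrow> bool" where
  "free_plot plot n U p \<longleftrightarrow> openin (Euclidean_space n) U \<and>
     (\<forall>u\<in>U. \<exists>V m r q. openin (Euclidean_space n) V \<and> u \<in> V \<and> V \<subseteq> U \<and>
        (\<forall>i<m. smooth_fun n V (r i) \<and> plot n V (q i)) \<and>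
        (\<forall>v\<in>V. p v = (\<Sum>i<(m::nat). r i v *\<^sub>R basis_elem (q i v))))"


section \<open>Topological vector spaces and the free topological vector space\<close>

text \<open>The underlying vector space is the linear subspace \<open>topspace T\<close> of the ambient type; whatever
  type-class topology that type may carry plays no role. No separation axiom is imposed.\<close>

definition topological_vector_space :: "'v::real_vector topology \<Rightarrow> bool" where
  "topological_vector_space T \<longleftrightarrow> subspace (topspace T) \<and>
     continuous_map (prod_topology T T) T (\<lambda>(x, y). x + y) \<and>
     continuous_map (prod_topology euclideanreal T) T (\<lambda>(c, x). c *\<^sub>R x)"

definition linear_map_on :: "'v::real_vector set \<Rightarrow> ('v \<Rightarrow> 'w::real_vector) \<Rightarrow> bool" where
  "linear_map_on S k \<longleftrightarrow> (\<forall>x\<in>S. \<forall>y\<in>S. k (x + y) = k x + k y) \<and> (\<forall>c. \<forall>x\<in>S. k (c *\<^sub>R x) = c *\<^sub>R k x)"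

text \<open>The universal property of a free topological vector space \<open>(T, j)\<close> on \<open>Y\<close>, for target spaces
  \<open>W\<close> inside the type \<open>'w\<close>; membership in \<^const>\<open>extensional\<close> makes uniqueness of \<open>k\<close> refer to its
  values on the vector space only.\<close>

definition is_free_tvs ::
  "'w::real_vector itself \<Rightarrow> 'a topology \<Rightarrow> 'v::real_vector topology \<Rightarrow> ('a \<Rightarrow> 'v) \<Rightarrow> bool" where
  "is_free_tvs _ Y T j \<longleftrightarrow> topological_vector_space T \<and> continuous_map Y T j \<and>
     (\<forall>(W :: 'w topology) h. topological_vector_space W \<and> continuous_map Y W h \<longrightarrow>
        (\<exists>!k. k \<in> extensional (topspace T) \<and> continuous_map T W k \<and> linear_map_on (topspace T) k \<and>
              (\<forall>y\<in>topspace Y. h y = k (j y))))"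

text \<open>A definition cannot quantify over all target types, so the universal property is required for
  targets inside \<open>'a \<Rightarrow>\<^sub>0 real\<close>, i.e. all topologized subspaces of that type. This already determines
  the topology, and implies the universal property for targets in every type: see
  \<open>free_tvs_unique\<close> and \<open>is_free_tvs_free_tvs\<close> below.\<close>

definition free_tvs :: "'a topology \<Rightarrow> ('a \<Rightarrow>\<^sub>0 real) topology" where
  "free_tvs Y = (THE T. topspace T = free_space (topspace Y) \<and>
     is_free_tvs TYPE('a \<Rightarrow>\<^sub>0 real) Y T basis_elem)"


subsection \<open>Well-definedness of the free topological vector space\<close>

lemma lookup_scaleR: "Poly_Mapping.lookup (c *\<^sub>R f) x = c *\<^sub>R Poly_Mapping.lookup f x"
proof -
  have "finite {y. c *\<^sub>R Poly_Mapping.lookup f y \<noteq> 0}"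
    by (rule finite_subset[OF _ finite_lookup[of f]]) auto
  then show ?thesis
    by (simp add: scaleR_poly_mapping_def)
qed

lemma subspace_free_space: "subspace (free_space X)"
  unfolding subspace_def free_space_def
  by (auto simp: subset_iff lookup_add lookup_scaleR simp flip: lookup_not_eq_zero_eq_in_keys)
    (metis add.right_neutral)

lemma basis_elem_in_free_space: "x \<in> X \<Longrightarrow> basis_elem x \<in> free_space X"
  by (simp add: basis_elem_def free_space_def)

lemma free_space_expansion:
  "f = (\<Sum>x\<in>Poly_Mapping.keys f. Poly_Mapping.lookup f x *\<^sub>R basis_elem x)"
proof (rule poly_mapping_eqI)
  fix y
  have "(\<Sum>x\<in>Poly_Mapping.keys f. Poly_Mapping.lookup (Poly_Mapping.lookup f x *\<^sub>R basis_elem x) y)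
      = (\<Sum>x\<in>Poly_Mapping.keys f. if x = y then Poly_Mapping.lookup f y else 0)"
    by (intro sum.cong) (auto simp: lookup_scaleR basis_elem_def lookup_single)
  also have "\<dots> = Poly_Mapping.lookup f y"
    by (simp add: in_keys_iff)
  finally show "Poly_Mapping.lookup f y = Poly_Mapping.lookup
      (\<Sum>x\<in>Poly_Mapping.keys f. Poly_Mapping.lookup f x *\<^sub>R basis_elem x) y"
    by (simp add: Poly_Mapping.lookup_sum)
qed

definition lin_ext :: "('a \<Rightarrow> 'w::real_vector) \<Rightarrow> ('a \<Rightarrow>\<^sub>0 real) \<Rightarrow> 'w" where
  "lin_ext h f = (\<Sum>x\<in>Poly_Mapping.keys f. Poly_Mapping.lookup f x *\<^sub>R h x)"

lemma lin_ext_superset: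
  assumes "finite A" "Poly_Mapping.keys f \<subseteq> A"
  shows "lin_ext h f = (\<Sum>x\<in>A. Poly_Mapping.lookup f x *\<^sub>R h x)"
  unfolding lin_ext_def using assms
  by (intro sum.mono_neutral_left) (auto simp: in_keys_iff)

lemma lin_ext_add: "lin_ext h (f + g) = lin_ext h f + lin_ext h g"
proof -
  let ?A = "Poly_Mapping.keys f \<union> Poly_Mapping.keys g"
  have "lin_ext h (f + g) = (\<Sum>x\<in>?A. Poly_Mapping.lookup (f + g) x *\<^sub>R h x)"
    by (rule lin_ext_superset) (use keys_add[of f g] in auto)
  moreover have "lin_ext h f = (\<Sum>x\<in>?A. Poly_Mapping.lookup f x *\<^sub>R h x)"
    by (rule lin_ext_superset) auto
  moreover have "lin_ext h g = (\<Sum>x\<in>?A. Poly_Mapping.lookup g x *\<^sub>R h x)"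
    by (rule lin_ext_superset) auto
  ultimately show ?thesis
    by (simp add: lookup_add scaleR_add_left sum.distrib)
qed

lemma lin_ext_scaleR: "lin_ext h (c *\<^sub>R f) = c *\<^sub>R lin_ext h f"
proof -
  have "lin_ext h (c *\<^sub>R f) = (\<Sum>x\<in>Poly_Mapping.keys f. Poly_Mapping.lookup (c *\<^sub>R f) x *\<^sub>R h x)"
    by (rule lin_ext_superset) (auto simp: in_keys_iff lookup_scaleR)
  then show ?thesis
    by (simp add: lin_ext_def lookup_scaleR scaleR_sum_right)
qed

lemma lin_ext_basis_elem: "lin_ext h (basis_elem x) = h x"
  by (simp add: lin_ext_def basis_elem_def)

lemma lin_ext_in:
  assumes "subspace S" "h ` X \<subseteq> S" "f \<in> free_space X"
  shows "lin_ext h f \<in> S"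
  unfolding lin_ext_def
  using assms by (intro subspace_sum subspace_scale) (auto simp: free_space_def)

lemma linear_map_on_free_space:
  assumes k: "linear_map_on (free_space X) k" and f: "f \<in> free_space X"
  shows "k f = lin_ext (\<lambda>x. k (basis_elem x)) f"
proof -
  have zero: "k 0 = 0"
    using k subspace_0[OF subspace_free_space[of X]] unfolding linear_map_on_def
    by (metis scaleR_zero_left)
  have "k (\<Sum>x\<in>A. c x *\<^sub>R basis_elem x) = (\<Sum>x\<in>A. c x *\<^sub>R k (basis_elem x))"
    if "finite A" "A \<subseteq> X" for A c
    using that
  proof (induction A rule: finite_induct)
    case (insert a A)
    have "c a *\<^sub>R basis_elem a \<in> free_space X" "basis_elem a \<in> free_space X"
      "(\<Sum>x\<in>A. c x *\<^sub>R basis_elem x) \<in> free_space X"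
      using insert.prems
      by (auto intro!: subspace_scale subspace_sum subspace_free_space basis_elem_in_free_space)
    then show ?case
      using insert k by (simp add: linear_map_on_def)
  qed (simp add: zero)
  from this[of "Poly_Mapping.keys f" "Poly_Mapping.lookup f"] f show ?thesis
    by (simp add: free_space_def lin_ext_def flip: free_space_expansion)
qed

lemma topological_vector_space_pullback:
  assumes W: "topological_vector_space W" and S: "subspace S"
    and k: "linear_map_on S k" "k ` S \<subseteq> topspace W"
  shows "topological_vector_space (pullback_topology S k W)" (is "topological_vector_space ?P")
proof -
  have top: "topspace ?P = S"
    using k by (auto simp: topspace_pullback_topology)
  have kc: "continuous_map ?P W k"
    using continuous_map_pullback[of W W id S k] by simp
  have "continuous_map (prod_topology ?P ?P) W ((\<lambda>(x, y). x + y) \<circ> (\<lambda>(x, y). (k x, k y)))"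
    using W kc unfolding topological_vector_space_def
    by (intro continuous_map_compose[where X' = "prod_topology W W"])
       (auto simp: continuous_map_prod_top)
  then have "continuous_map (prod_topology ?P ?P) W (k \<circ> (\<lambda>(x, y). x + y))"
    by (rule continuous_map_eq) (use k top in \<open>auto simp: linear_map_on_def\<close>)
  then have add: "continuous_map (prod_topology ?P ?P) ?P (\<lambda>(x, y). x + y)"
    by (rule continuous_map_pullback') (use S top in \<open>auto simp: subspace_add\<close>)
  have "continuous_map (prod_topology euclideanreal ?P) W
          ((\<lambda>(c, x). c *\<^sub>R x) \<circ> (\<lambda>(c, x). (id c, k x)))"
    using W kc unfolding topological_vector_space_def
    by (intro continuous_map_compose[where X' = "prod_topology euclideanreal W"])
       (auto simp only: continuous_map_prod_top continuous_map_id)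
  then have "continuous_map (prod_topology euclideanreal ?P) W (k \<circ> (\<lambda>(c, x). c *\<^sub>R x))"
    by (rule continuous_map_eq) (use k top in \<open>auto simp: linear_map_on_def\<close>)
  then have "continuous_map (prod_topology euclideanreal ?P) ?P (\<lambda>(c, x). c *\<^sub>R x)"
    by (rule continuous_map_pullback') (use S top in \<open>auto simp: subspace_scale\<close>)
  with add show ?thesis
    using S by (simp add: topological_vector_space_def top)
qed

lemma is_free_tvs_all_targets:
  fixes T :: "('a \<Rightarrow>\<^sub>0 real) topology"
  assumes top: "topspace T = free_space (topspace Y)"
    and tvs: "topological_vector_space T" and j: "continuous_map Y T basis_elem"
    and finest: "\<And>S. topspace S = free_space (topspace Y) \<Longrightarrow> topological_vector_space S \<Longrightarrow>
                   continuous_map Y S basis_elem \<Longrightarrow> coarser_topology S T"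
  shows "is_free_tvs TYPE('w::real_vector) Y T basis_elem"
  unfolding is_free_tvs_def
proof (intro conjI allI impI tvs j)
  fix W :: "'w topology" and h
  assume "topological_vector_space W \<and> continuous_map Y W h"
  then have W: "topological_vector_space W" and h: "continuous_map Y W h" by auto
  let ?F = "free_space (topspace Y)" and ?k = "lin_ext h"
  let ?P = "pullback_topology ?F ?k W"
  have kS: "?k ` ?F \<subseteq> topspace W"
    using W lin_ext_in[OF _ continuous_map_image_subset_topspace[OF h]]
    by (auto simp: topological_vector_space_def)
  have lin: "linear_map_on ?F ?k"
    by (simp add: linear_map_on_def lin_ext_add lin_ext_scaleR)
  have Ptop: "topspace ?P = ?F"
    using kS by (auto simp: topspace_pullback_topology)
  have "continuous_map Y ?P basis_elem"
    by (rule continuous_map_pullback')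
       (use h in \<open>auto simp: lin_ext_basis_elem comp_def basis_elem_in_free_space\<close>)
  then have "coarser_topology ?P T"
    using finest Ptop topological_vector_space_pullback[OF W subspace_free_space lin kS] by blast
  then have "continuous_map T ?P id"
    by (simp add: coarser_topology_iff_continuous_id Ptop top)
  moreover have "continuous_map ?P W ?k"
    using continuous_map_pullback[of W W id ?F ?k] by simp
  ultimately have kT: "continuous_map T W ?k"
    using continuous_map_compose by fastforce
  show "\<exists>!k. k \<in> extensional (topspace T) \<and> continuous_map T W k \<and> linear_map_on (topspace T) k \<and>
              (\<forall>y\<in>topspace Y. h y = k (basis_elem y))"
  proof (rule ex1I[where a = "restrict ?k ?F"])
    have "continuous_map T W (restrict ?k ?F)"
      using kT by (rule continuous_map_eq) (simp add: top)
    moreover have "linear_map_on ?F (restrict ?k ?F)"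
      using lin subspace_free_space[of "topspace Y"]
      by (auto simp: linear_map_on_def subspace_add subspace_scale)
    ultimately show "restrict ?k ?F \<in> extensional (topspace T) \<and> continuous_map T W (restrict ?k ?F) \<and>
        linear_map_on (topspace T) (restrict ?k ?F) \<and>
        (\<forall>y\<in>topspace Y. h y = restrict ?k ?F (basis_elem y))"
      by (auto simp: top basis_elem_in_free_space lin_ext_basis_elem)
  next
    fix k assume k: "k \<in> extensional (topspace T) \<and> continuous_map T W k \<and>
        linear_map_on (topspace T) k \<and> (\<forall>y\<in>topspace Y. h y = k (basis_elem y))"
    show "k = restrict ?k ?F"
    proof (rule extensionalityI[where A = ?F])
      fix f assume f: "f \<in> ?F"
      then have "k f = lin_ext (\<lambda>x. k (basis_elem x)) f"
        using k top linear_map_on_free_space by metis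
      also have "\<dots> = lin_ext h f"
        unfolding lin_ext_def using f k by (intro sum.cong) (auto simp: free_space_def)
      finally show "k f = restrict ?k ?F f" using f by simp
    qed (use k top in auto)
  qed
qed

lemma free_tvs_unique:
  fixes T T' :: "('a \<Rightarrow>\<^sub>0 real) topology"
  assumes "topspace T = free_space (topspace Y)" "is_free_tvs TYPE('a \<Rightarrow>\<^sub>0 real) Y T basis_elem"
    and "topspace T' = free_space (topspace Y)" "is_free_tvs TYPE('a \<Rightarrow>\<^sub>0 real) Y T' basis_elem"
  shows "T = T'"
proof -
  have *: "coarser_topology T' T"
    if T: "topspace T = free_space (topspace Y)" "is_free_tvs TYPE('a \<Rightarrow>\<^sub>0 real) Y T basis_elem"
      and T': "topspace T' = free_space (topspace Y)"
        "is_free_tvs TYPE('a \<Rightarrow>\<^sub>0 real) Y T' basis_elem"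
    for T T' :: "('a \<Rightarrow>\<^sub>0 real) topology"
  proof -
    have "topological_vector_space T'" "continuous_map Y T' basis_elem"
      using T' by (auto simp: is_free_tvs_def)
    then obtain k where k: "continuous_map T T' k" "linear_map_on (topspace T) k"
        "\<forall>y\<in>topspace Y. basis_elem y = k (basis_elem y)"
      using T(2) unfolding is_free_tvs_def by metis
    have "k f = f" if f: "f \<in> topspace T" for f
    proof -
      have "k f = lin_ext (\<lambda>x. k (basis_elem x)) f"
        using k f T linear_map_on_free_space by metis
      also have "\<dots> = lin_ext basis_elem f"
        unfolding lin_ext_def using f k T by (intro sum.cong) (auto simp: free_space_def)
      also have "\<dots> = f"
        unfolding lin_ext_def by (simp flip: free_space_expansion)
      finally show ?thesis .
    qed
    then have "continuous_map T T' id"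
      using continuous_map_eq[OF k(1)] by (metis id_apply)
    then show ?thesis
      using T T' by (simp add: coarser_topology_iff_continuous_id)
  qed
  show ?thesis
    using *[of T T'] *[of T' T] assms by (auto simp: coarser_topology_def topology_eq)
qed

lemma finest_tvs_exists:
  obtains T :: "('a \<Rightarrow>\<^sub>0 real) topology"
  where "topspace T = free_space (topspace Y)" "topological_vector_space T"
    "continuous_map Y T basis_elem"
    "\<And>S. topspace S = free_space (topspace Y) \<Longrightarrow> topological_vector_space S \<Longrightarrow>
       continuous_map Y S basis_elem \<Longrightarrow> coarser_topology S T"
proof -
  let ?F = "free_space (topspace Y)"
  define \<T> where "\<T> = {S. topspace S = ?F \<and> topological_vector_space S \<and>
                             continuous_map Y S basis_elem}"
  define B where "B = insert ?F {V. \<exists>S\<in>\<T>. openin S V}"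
  define T where "T = topology_generated_by B"
  have UB: "\<Union>B = ?F"
    by (auto simp: B_def \<T>_def dest: openin_subset)
  have top: "topspace T = ?F"
    unfolding T_def topology_generated_by_topspace UB ..
  have coarse: "coarser_topology S T" if "S \<in> \<T>" for S
    using that top unfolding coarser_topology_def T_def
    by (auto simp: \<T>_def B_def intro!: topology_generated_by_Basis)
  have idc: "continuous_map T S id" if "S \<in> \<T>" for S
    using coarse[OF that] that top by (simp add: coarser_topology_iff_continuous_id \<T>_def)
  have into: "continuous_map Z T g"
    if "g ` topspace Z \<subseteq> ?F" "\<And>S. S \<in> \<T> \<Longrightarrow> continuous_map Z S g"
    for Z :: "'z topology" and g
    unfolding T_def
  proof (rule continuous_on_generated_topo)
    fix V assume "V \<in> B"
    then consider "V = ?F" | S where "S \<in> \<T>" "openin S V" by (auto simp: B_def)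
    then show "openin Z (g -` V \<inter> topspace Z)"
    proof cases
      case 1
      then have "g -` V \<inter> topspace Z = topspace Z" using that(1) by auto
      then show ?thesis by simp
    next
      case 2
      then have "openin Z {x \<in> topspace Z. g x \<in> V}"
        using that(2) openin_continuous_map_preimage by blast
      moreover have "g -` V \<inter> topspace Z = {x \<in> topspace Z. g x \<in> V}" by auto
      ultimately show ?thesis by simp
    qed
  qed (use that UB in auto)
  have "continuous_map (prod_topology T T) T (\<lambda>(x, y). x + y)"
  proof (rule into)
    fix S assume S: "S \<in> \<T>"
    have "continuous_map (prod_topology T T) S ((\<lambda>(x, y). x + y) \<circ> (\<lambda>(x, y). (id x, id y)))"
      using S idc[OF S] by (intro continuous_map_compose[where X' = "prod_topology S S"])
        (auto simp only: continuous_map_prod_top \<T>_def topological_vector_space_def)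
    then show "continuous_map (prod_topology T T) S (\<lambda>(x, y). x + y)"
      by (simp add: comp_def case_prod_unfold)
  qed (auto simp: top subspace_add[OF subspace_free_space])
  moreover have "continuous_map (prod_topology euclideanreal T) T (\<lambda>(c, x). c *\<^sub>R x)"
  proof (rule into)
    fix S assume S: "S \<in> \<T>"
    have "continuous_map (prod_topology euclideanreal T) S
            ((\<lambda>(c, x). c *\<^sub>R x) \<circ> (\<lambda>(c, x). (id c, id x)))"
      using S idc[OF S]
      by (intro continuous_map_compose[where X' = "prod_topology euclideanreal S"])
        (auto simp only: continuous_map_prod_top continuous_map_id \<T>_def
          topological_vector_space_def)
    then show "continuous_map (prod_topology euclideanreal T) S (\<lambda>(c, x). c *\<^sub>R x)"
      by (simp add: comp_def case_prod_unfold)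
  qed (auto simp: top subspace_scale[OF subspace_free_space])
  moreover have "continuous_map Y T basis_elem"
    by (rule into) (auto simp: basis_elem_in_free_space \<T>_def)
  ultimately show ?thesis
    using that[of T] top coarse subspace_free_space
    by (auto simp: topological_vector_space_def \<T>_def)
qed

lemma
  shows topspace_free_tvs: "topspace (free_tvs Y) = free_space (topspace Y)"
    and is_free_tvs_free_tvs: "is_free_tvs TYPE('w::real_vector) Y (free_tvs Y) basis_elem"
proof -
  obtain T where T: "topspace T = free_space (topspace Y)" "topological_vector_space T"
    "continuous_map Y T basis_elem"
    "\<And>S. topspace S = free_space (topspace Y) \<Longrightarrow> topological_vector_space S \<Longrightarrow>
       continuous_map Y S basis_elem \<Longrightarrow> coarser_topology S T"
    using finest_tvs_exists[of Y] by blast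
  have eq: "free_tvs Y = T"
    unfolding free_tvs_def
    by (rule the_equality)
       (use T(1) is_free_tvs_all_targets[OF T] free_tvs_unique in blast)+
  show "topspace (free_tvs Y) = free_space (topspace Y)"
    by (simp add: eq T)
  show "is_free_tvs TYPE('w) Y (free_tvs Y) basis_elem"
    unfolding eq using is_free_tvs_all_targets[OF T] by blast
qed

end

theory Submission
  imports Defs
begin

text \<open>Both topologies on \<open>free_space X\<close> are the finest of their kind: that of
  D(F(X)) among all topologies that make the free plots continuous, that of G(D(X)) among all vector
  space topologies that make \<open>basis_elem\<close> continuous on D(X). Each half of the theorem
  shows that one topology competes in the class where the other is finest. In a vector space
  topology with \<open>basis_elem\<close> continuous, a free plot is locally a finite sum of
  continuous coefficients times basis elements of plots, hence continuous
  (\<open>plots_continuous_free_plot\<close>). Applied to G(D(X)), this gives the inclusion.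
  Conversely, \<open>basis_elem\<close> sends plots to free plots, so it is continuous into D(F(X))
  (\<open>continuous_map_basis_elem_D_free\<close>). Once D(F(X)) is a topological vector space,
  \<open>free_tvs_finest\<close> bounds it by G(D(X)).\<close>

context diffeological_space
begin

lemma topspace_D: "topspace (D_topology X plot) = X"
  by (rule topspace_D_topology) (fact plot_domain plot_range)+

lemma openin_D:
  "openin (D_topology X plot) V \<longleftrightarrow>
     V \<subseteq> X \<and> (\<forall>n U p. plot n U p \<longrightarrow> openin (Euclidean_space n) {u \<in> U. p u \<in> V})"
  by (rule openin_D_topology) (fact plot_domain plot_range)+

lemma plots_continuous_D: "plots_continuous plot (D_topology X plot)"
  by (rule plots_continuous_D_topology) (fact plot_domain plot_range)+

text \<open>The D-topology is final for the plots, so continuity out of it can be tested after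
  composing with each plot.\<close>

lemma continuous_map_from_D_topology:
  assumes "f ` X \<subseteq> topspace Z"
    and "\<And>n U p. plot n U p \<Longrightarrow> continuous_map (subtopology (Euclidean_space n) U) Z (f \<circ> p)"
  shows "continuous_map (D_topology X plot) Z f"
  unfolding continuous_map_def topspace_D
proof (intro conjI allI impI)
  fix W assume W: "openin Z W"
  show "openin (D_topology X plot) {x \<in> X. f x \<in> W}"
    unfolding openin_D
  proof (intro conjI allI impI)
    fix n U p assume pl: "plot n U p"
    have U: "openin (Euclidean_space n) U"
      using plot_domain[OF pl] .
    have "openin (subtopology (Euclidean_space n) U)
        {u \<in> topspace (subtopology (Euclidean_space n) U). (f \<circ> p) u \<in> W}"
      using openin_continuous_map_preimage[OF assms(2)[OF pl] W] .
    moreover have "{u \<in> topspace (subtopology (Euclidean_space n) U). (f \<circ> p) u \<in> W}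
        = {u \<in> U. p u \<in> {x \<in> X. f x \<in> W}}"
      \<comment> \<open>The condition \<open>p u \<in> X\<close> is automatic on \<open>U\<close>,
        and \<open>U\<close> lies inside the Euclidean space.\<close>
      using plot_range[OF pl] openin_subset[OF U] by auto
    ultimately show "openin (Euclidean_space n) {u \<in> U. p u \<in> {x \<in> X. f x \<in> W}}"
      using U openin_trans_full by metis
  qed auto
qed (use assms(1) in auto)

end

lemma smooth_fun_const: "smooth_fun n U (\<lambda>_. c)"
proof -
  have "Ck_on n U k (\<lambda>_. c)" for k c
  \<comment> \<open>The partial derivatives are the constant 0, so the induction hypothesis is
    needed at 0 rather than at \<open>c\<close>.\<close>
  proof (induction k arbitrary: c)
    case (Suc k)
    then show ?case
      by (auto intro!: exI[of _ "\<lambda>_. 0"])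
  qed simp
  then show ?thesis
    by (simp add: smooth_fun_def)
qed

lemma smooth_fun_imp_continuous_map:
  "smooth_fun n U f \<Longrightarrow> continuous_map (subtopology (Euclidean_space n) U) euclideanreal f"
  unfolding smooth_fun_def by (metis Ck_on.simps(1))

lemma continuous_map_tvs_add:
  assumes "topological_vector_space T" "continuous_map Z T f" "continuous_map Z T g"
  shows "continuous_map Z T (\<lambda>z. f z + g z)"
proof -
  have "continuous_map Z T ((\<lambda>(x, y). x + y) \<circ> (\<lambda>z. (f z, g z)))"
    using assms unfolding topological_vector_space_def
    by (intro continuous_map_compose[where X' = "prod_topology T T"]
        continuous_map_paired[THEN iffD2]) auto
  then show ?thesis by (simp add: comp_def)
qed

lemma continuous_map_tvs_scaleR:
  assumes "topological_vector_space T" "continuous_map Z euclideanreal r" "continuous_map Z T f"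
  shows "continuous_map Z T (\<lambda>z. r z *\<^sub>R f z)"
proof -
  have "continuous_map Z T ((\<lambda>(c, x). c *\<^sub>R x) \<circ> (\<lambda>z. (r z, f z)))"
    using assms unfolding topological_vector_space_def
    by (intro continuous_map_compose[where X' = "prod_topology euclideanreal T"]
        continuous_map_paired[THEN iffD2]) auto
  then show ?thesis by (simp add: comp_def)
qed

lemma continuous_map_tvs_sum:
  assumes "topological_vector_space T" "finite I" "\<And>i. i \<in> I \<Longrightarrow> continuous_map Z T (f i)"
  shows "continuous_map Z T (\<lambda>z. \<Sum>i\<in>I. f i z)"
  using assms(2,3)
proof (induction I rule: finite_induct)
  \<comment> \<open>The empty sum is the constant map 0, which lands in the space because that is a
    subspace.\<close>
  case empty
  then show ?case
    using assms(1) by (simp add: topological_vector_space_def subspace_0)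
qed (simp add: continuous_map_tvs_add[OF assms(1)])

context diffeological_space
begin

lemma free_plot_domain: "free_plot plot n U p \<Longrightarrow> openin (Euclidean_space n) U"
  by (simp add: free_plot_def)

lemma free_plot_range:
  assumes "free_plot plot n U p"
  shows "p ` U \<subseteq> free_space X"
proof clarify
  fix u assume "u \<in> U"
  then obtain V and m :: nat and r q where "u \<in> V"
    and q: "\<forall>i<m. smooth_fun n V (r i) \<and> plot n V (q i)"
    and eq: "\<forall>v\<in>V. p v = (\<Sum>i<m. r i v *\<^sub>R basis_elem (q i v))"
    using assms unfolding free_plot_def by blast
  have "q i u \<in> X" if "i < m" for i
    using q plot_range \<open>u \<in> V\<close> that by blast
  then have "(\<Sum>i<m. r i u *\<^sub>R basis_elem (q i u)) \<in> free_space X"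
    by (auto intro!: subspace_sum subspace_scale subspace_free_space basis_elem_in_free_space)
  then show "p u \<in> free_space X"
    using eq \<open>u \<in> V\<close> by simp
qed

lemma topspace_D_free: "topspace (D_topology (free_space X) (free_plot plot)) = free_space X"
  by (rule topspace_D_topology) (fact free_plot_domain free_plot_range)+

lemma plots_continuous_D_free:
  "plots_continuous (free_plot plot) (D_topology (free_space X) (free_plot plot))"
  by (rule plots_continuous_D_topology) (fact free_plot_domain free_plot_range)+

text \<open>The required local form holds globally: one summand with constant coefficient 1, and
  \<open>V = U\<close> at every point.\<close>

lemma free_plot_basis_elem:
  assumes "plot n U p"
  shows "free_plot plot n U (basis_elem \<circ> p)"
  unfolding free_plot_def
proof (intro conjI ballI)
  fix u assume "u \<in> U"
  then show "\<exists>V m r q. openin (Euclidean_space n) V \<and> u \<in> V \<and> V \<subseteq> U \<and>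
      (\<forall>i<m. smooth_fun n V (r i) \<and> plot n V (q i)) \<and>
      (\<forall>v\<in>V. (basis_elem \<circ> p) v = (\<Sum>i<(m::nat). r i v *\<^sub>R basis_elem (q i v)))"
    using assms plot_domain[OF assms] smooth_fun_const
    by (intro exI[of _ U] exI[of _ 1] exI[of _ "\<lambda>_ _. 1"] exI[of _ "\<lambda>_. p"]) auto
qed (rule plot_domain[OF assms])

text \<open>Only continuity of the smooth coefficients is used; it combines with continuity of the
  vector operations and of plots into D(X).\<close>

lemma plots_continuous_free_plot:
  assumes T: "topological_vector_space T"
    and basis: "continuous_map (D_topology X plot) T basis_elem"
  shows "plots_continuous (free_plot plot) T"
  unfolding plots_continuous_def
proof (intro allI impI)
  fix n U p assume p: "free_plot plot n U p"
  \<comment> \<open>Continuity is local: it suffices that the open sets on which \<open>p\<close> is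
    continuous cover \<open>U\<close>.\<close>
  define \<V> where "\<V> = {V. openin (Euclidean_space n) V \<and> V \<subseteq> U \<and>
      continuous_map (subtopology (Euclidean_space n) V) T p}"
  show "continuous_map (subtopology (Euclidean_space n) U) T p"
  proof (rule pasting_lemma[where I = \<V> and T = "\<lambda>V. V" and f = "\<lambda>_. p"])
    fix V assume "V \<in> \<V>"
    then show "openin (subtopology (Euclidean_space n) U) V"
      "continuous_map (subtopology (subtopology (Euclidean_space n) U) V) T p"
      by (auto simp: \<V>_def subset_openin_subtopology subtopology_subtopology Int_absorb1)
  next
    fix u assume "u \<in> topspace (subtopology (Euclidean_space n) U)"
    then have "u \<in> U" by simp
    then obtain V and m :: nat and r q where V: "openin (Euclidean_space n) V" "u \<in> V" "V \<subseteq> U"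
      and rq: "\<forall>i<m. smooth_fun n V (r i) \<and> plot n V (q i)"
      and eq: "\<forall>v\<in>V. p v = (\<Sum>i<m. r i v *\<^sub>R basis_elem (q i v))"
      using p unfolding free_plot_def by blast
    let ?V = "subtopology (Euclidean_space n) V"
    have "continuous_map ?V T (\<lambda>v. \<Sum>i<m. r i v *\<^sub>R basis_elem (q i v))"
    proof (intro continuous_map_tvs_sum[OF T] continuous_map_tvs_scaleR[OF T])
      fix i assume i: "i \<in> {..<m}"
      then show "continuous_map ?V euclideanreal (r i)"
        using rq smooth_fun_imp_continuous_map by blast
      have "continuous_map ?V (D_topology X plot) (q i)"
        using rq i plots_continuous_D unfolding plots_continuous_def by blast
      then show "continuous_map ?V T (\<lambda>v. basis_elem (q i v))"
        using continuous_map_compose[OF _ basis] by (auto simp: comp_def)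
    qed simp
    \<comment> \<open>\<open>p\<close> equals the sum only on \<open>V\<close>, which is all that
      the subspace topology sees.\<close>
    then have "continuous_map ?V T p"
      by (rule continuous_map_eq) (simp add: eq)
    then show "\<exists>V. V \<in> \<V> \<and> u \<in> V \<and> p u = p u"
      using V by (auto simp: \<V>_def)
  qed simp
qed

lemma continuous_map_basis_elem_D_free:
  "continuous_map (D_topology X plot) (D_topology (free_space X) (free_plot plot)) basis_elem"
proof (rule continuous_map_from_D_topology)
  fix n U p assume "plot n U p"
  from free_plot_basis_elem[OF this]
  show "continuous_map (subtopology (Euclidean_space n) U)
      (D_topology (free_space X) (free_plot plot)) (basis_elem \<circ> p)"
    using plots_continuous_D_free unfolding plots_continuous_def by metis
qed (auto simp: topspace_D_free basis_elem_in_free_space)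

end

text \<open>\<open>free_tvs\<close> is specified by a universal property. The finest admissible
  vector space topology has this property too, so uniqueness identifies the two.\<close>

lemma free_tvs_finest:
  assumes S: "topspace S = free_space (topspace Y)" "topological_vector_space S"
    and basis: "continuous_map Y S basis_elem"
  shows "coarser_topology S (free_tvs Y)"
proof -
  obtain T where T: "topspace T = free_space (topspace Y)" "topological_vector_space T"
    "continuous_map Y T basis_elem"
    and finest: "\<And>S. topspace S = free_space (topspace Y) \<Longrightarrow> topological_vector_space S \<Longrightarrow>
       continuous_map Y S basis_elem \<Longrightarrow> coarser_topology S T"
    using finest_tvs_exists[of Y] by blast
  have "free_tvs Y = T"
    using free_tvs_unique[OF topspace_free_tvs is_free_tvs_free_tvs T(1)
        is_free_tvs_all_targets[OF T finest]] .
  then show ?thesis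
    using finest[OF S basis] by simp
qed

theorem proposition4p1:
  fixes X :: "'a set"
    and plot :: "nat \<Rightarrow> (nat \<Rightarrow> real) set \<Rightarrow> ((nat \<Rightarrow> real) \<Rightarrow> 'a) \<Rightarrow> bool"
  assumes "diffeological_space X plot"
    and "Tychonoff_space (D_topology X plot)"
  shows "coarser_topology (free_tvs (D_topology X plot))
           (D_topology (free_space X) (free_plot plot)) \<and>
         (topological_vector_space (D_topology (free_space X) (free_plot plot)) \<longrightarrow>
           D_topology (free_space X) (free_plot plot) = free_tvs (D_topology X plot))"
proof -
  interpret diffeological_space X plot
    by fact
  let ?G = "free_tvs (D_topology X plot)" and ?F = "D_topology (free_space X) (free_plot plot)"
  have "topological_vector_space ?G" "continuous_map (D_topology X plot) ?G basis_elem"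
    using is_free_tvs_free_tvs[where 'w = "'a \<Rightarrow>\<^sub>0 real", of "D_topology X plot"]
    by (auto simp: is_free_tvs_def)
  then have "plots_continuous (free_plot plot) ?G"
    by (rule plots_continuous_free_plot)
  then have coarser: "coarser_topology ?G ?F"
    by (intro D_topology_finest free_plot_domain free_plot_range)
      (auto simp: topspace_free_tvs topspace_D)
  moreover have "?F = ?G" if "topological_vector_space ?F"
  proof -
    have "coarser_topology ?F ?G"
      using that continuous_map_basis_elem_D_free
      by (intro free_tvs_finest) (auto simp: topspace_D topspace_D_free)
    \<comment> \<open>Two topologies each coarser than the other have the same open sets.\<close>
    with coarser show ?thesis
      by (auto simp: coarser_topology_def topology_eq)
  qed
  ultimately show ?thesis
    by blast
qed

end
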